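(* Let $\mathcal{A}$ be a finite set and let $x\in\mathcal{A}^{\mathbb{Z}}$ be a sequence such that the corresponding dynamical system $(\overline{\mathcal{O}(x)},T)$ has an invariant Borel probability measure $\mu$ with $\operatorname{supp}\mu=\overline{\mathcal{O}(x)}$ and $(\overline{\mathcal{O}(x)},T,\mu)$ weakly mixing. Then for each $W_1,W_2\in\mathcal{L}_x$ there is a subset $J(W_1,W_2)\subset\mathbb{Z}_{\ge0}$ of density zero such that for any $W_1,W_2\in\mathcal{L}_x$ and any $n\in\mathbb{Z}_{\ge0}\setminus J(W_1,W_2)$, $$[W_1]\cap T^{-n}[W_2]\neq\emptyset.$$
   Context: $\mathcal{A}^{\mathbb{Z}}$ carries the product topology ($\mathcal{A}$ discrete). $T$ is the left shift: $T((x_n)_n)=(y_n)_n$ with $y_n=x_{n+1}$. The orbit closure is $\overline{\mathcal{O}(x)}=\overline{\{T^n(x)\mid n\in\mathbb{Z}\}}$. The language of $x$ is $\mathcal{L}_x=\{x_nx_{n+1}\cdots x_{n+m}\mid n\in\mathbb{Z},m\in\mathbb{Z}_{\ge0}\}$. For a word $W$ of length $|W|$, the cylinder set is $[W]=\{y\in\overline{\mathcal{O}(x)}\mid y_0y_1\cdots y_{|W|-1}=W\}$. A subset $J\subset\mathbb{Z}_{\ge0}$ has density zero if $\limsup_{N\to\infty}\frac{\operatorname{card}(J\cap[0,N])}{N+1}=0$. *)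

theory Defs
  imports "HOL-Probability.Probability"
begin

definition full_shift :: "'a set \<Rightarrow> (int \<Rightarrow> 'a) topology" where
  "full_shift A = product_topology (\<lambda>_::int. discrete_topology A) UNIV"

definition shift :: "(int \<Rightarrow> 'a) \<Rightarrow> (int \<Rightarrow> 'a)" where
  "shift x = (\<lambda>n. x (n + 1))"

definition shift_power :: "int \<Rightarrow> (int \<Rightarrow> 'a) \<Rightarrow> (int \<Rightarrow> 'a)" where
  "shift_power n = (if 0 \<le> n then shift ^^ nat n else inv shift ^^ nat (- n))"

lemma bij_shift: "bij shift"
  by (rule o_bij[where g = "\<lambda>x n. x (n - 1)"]) (auto simp: shift_def fun_eq_iff)

lemma inv_shift: "inv shift x = (\<lambda>n. x (n - 1))"
  by (rule inv_f_eq) (auto simp: bij_is_inj[OF bij_shift] shift_def)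

lemma shift_power_apply: "shift_power n x k = x (k + n)"
proof -
  have "(shift ^^ m) x k = x (k + int m)" for m k
    by (induction m arbitrary: k) (auto simp: shift_def algebra_simps)
  moreover have "(inv shift ^^ m) x k = x (k - int m)" for m k
    by (induction m arbitrary: k) (auto simp: inv_shift algebra_simps)
  ultimately show ?thesis
    by (auto simp: shift_power_def)
qed

definition orbit_closure :: "'a set \<Rightarrow> (int \<Rightarrow> 'a) \<Rightarrow> (int \<Rightarrow> 'a) set" where
  "orbit_closure A x = full_shift A closure_of {shift_power n x | n. True}"

text \<open>The orbit closure as a topological space, with the topology inherited from the full shift.\<close>

definition orbit_system :: "'a set \<Rightarrow> (int \<Rightarrow> 'a) \<Rightarrow> (int \<Rightarrow> 'a) topology" where
  "orbit_system A x = subtopology (full_shift A) (orbit_closure A x)"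

text \<open>Words are lists; the list \<open>[n..n + int m]\<close> has \<open>m + 1\<close> entries, so words are nonempty.\<close>

definition language :: "(int \<Rightarrow> 'a) \<Rightarrow> 'a list set" where
  "language x = {map x [n..n + int m] | n m. True}"

definition cylinder :: "'a set \<Rightarrow> (int \<Rightarrow> 'a) \<Rightarrow> 'a list \<Rightarrow> (int \<Rightarrow> 'a) set" where
  "cylinder A x W = {y \<in> orbit_closure A x. map y [0..int (length W) - 1] = W}"

definition density_zero :: "nat set \<Rightarrow> bool" where
  "density_zero J \<longleftrightarrow>
     limsup (\<lambda>N. ereal (real (card (J \<inter> {0..N})) / real (N + 1))) = 0"

definition borel_prob_measure :: "'b topology \<Rightarrow> 'b measure \<Rightarrow> bool" where
  "borel_prob_measure X M \<longleftrightarrow>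
     prob_space M \<and> space M = topspace X \<and> sets M = sigma_sets (topspace X) {U. openin X U}"

definition measure_support :: "'b topology \<Rightarrow> 'b measure \<Rightarrow> 'b set" where
  "measure_support X M =
     {p \<in> topspace X. \<forall>U. openin X U \<and> p \<in> U \<longrightarrow> emeasure M U > 0}"

definition invariant_measure :: "'b measure \<Rightarrow> ('b \<Rightarrow> 'b) \<Rightarrow> bool" where
  "invariant_measure M T \<longleftrightarrow>
     T \<in> measurable M M \<and> (\<forall>B\<in>sets M. emeasure M (T -` B \<inter> space M) = emeasure M B)"

text \<open>
  Weak mixing of a measure-preserving system, in the form of Cesaro convergence of absolute
  correlations (as in Walters, An Introduction to Ergodic Theory). The preimage is taken in the
  ambient type; intersecting with the measurable set \<open>C\<close> brings it back into the space.
\<close>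

definition weakly_mixing :: "'b measure \<Rightarrow> ('b \<Rightarrow> 'b) \<Rightarrow> bool" where
  "weakly_mixing M T \<longleftrightarrow>
     (\<forall>B\<in>sets M. \<forall>C\<in>sets M.
        (\<lambda>N. (\<Sum>n<N. \<bar>measure M ((T ^^ n) -` B \<inter> C) - measure M B * measure M C\<bar>) / real N)
          \<longlonglongrightarrow> 0)"

end

theory Submission
  imports Defs
begin

text \<open>
  Take for the exceptional set of \<open>W1\<close> and \<open>W2\<close> all times \<open>n\<close> at which
  \<open>[W1] \<inter> T\<^sup>-\<^sup>n [W2]\<close> is empty, so that only its density is in question. A cylinder of a word of
  the language is an open subset of the orbit closure containing a translate of \<open>x\<close>; as \<open>\<mu>\<close> has
  full support, it has positive measure (\<open>cylinder_measure_pos\<close>). At an exceptional time the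
  correlation \<open>\<bar>\<mu> ([W1] \<inter> T\<^sup>-\<^sup>n [W2]) - \<mu> [W1] * \<mu> [W2]\<bar>\<close> is therefore the fixed positive number
  \<open>\<mu> [W1] * \<mu> [W2]\<close>. Weak mixing makes the Cesaro means of these correlations vanish, which leaves
  room only for a set of exceptional times of density zero (\<open>density_zero_if_cesaro_null\<close>).
\<close>

text \<open>Markov's inequality for the uniform distribution on \<open>{0..N}\<close>: the proportion of times at
  which \<open>f\<close> is at least \<open>c\<close> is at most the mean of \<open>f\<close> divided by \<open>c\<close>.\<close>

lemma density_zero_if_cesaro_null:
  fixes f :: "nat \<Rightarrow> real"
  assumes nonneg: "\<And>n. 0 \<le> f n"
    and "0 < c"
    and large: "\<And>n. n \<in> J \<Longrightarrow> c \<le> f n"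
    and null: "(\<lambda>N. (\<Sum>n<N. f n) / real N) \<longlonglongrightarrow> 0"
  shows "density_zero J"
proof -
  let ?d = "\<lambda>N. real (card (J \<inter> {0..N})) / real (N + 1)"
  have bound: "?d N \<le> (\<Sum>n<Suc N. f n) / real (Suc N) / c" for N
  proof -
    have "real (card (J \<inter> {0..N})) * c = (\<Sum>n\<in>J \<inter> {0..N}. c)"
      by simp
    also have "\<dots> \<le> (\<Sum>n\<in>J \<inter> {0..N}. f n)"
      by (rule sum_mono) (simp add: large)
    also have "\<dots> \<le> (\<Sum>n<Suc N. f n)"
      by (rule sum_mono2) (auto simp: nonneg)
    finally have "real (card (J \<inter> {0..N})) \<le> (\<Sum>n<Suc N. f n) / c"
      using \<open>0 < c\<close> by (simp add: pos_le_divide_eq)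
    then have "?d N \<le> (\<Sum>n<Suc N. f n) / c / real (Suc N)"
      unfolding Suc_eq_plus1 by (intro divide_right_mono of_nat_0_le_iff)
    then show ?thesis
      by (metis divide_divide_eq_left mult.commute)
  qed
  have "(\<lambda>N. (\<Sum>n<Suc N. f n) / real (Suc N) / c) \<longlonglongrightarrow> 0"
    using tendsto_divide[OF LIMSEQ_Suc[OF null] tendsto_const, of c] \<open>0 < c\<close> by simp
  then have "?d \<longlonglongrightarrow> 0"
    by (rule tendsto_sandwich[OF always_eventually always_eventually tendsto_const, rotated 2])
      (intro allI bound divide_nonneg_nonneg of_nat_0_le_iff)+
  then have "(\<lambda>N. ereal (?d N)) \<longlonglongrightarrow> ereal 0"
    by (rule tendsto_ereal)
  then show ?thesis
    unfolding density_zero_def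
    by (metis lim_imp_Limsup trivial_limit_sequentially zero_ereal_def)
qed

lemma topspace_full_shift: "y \<in> topspace (full_shift A) \<longleftrightarrow> (\<forall>n. y n \<in> A)"
  by (auto simp: full_shift_def PiE_def)

lemma shift_power_in_orbit_closure:
  assumes "x \<in> UNIV \<rightarrow> A"
  shows "shift_power n x \<in> orbit_closure A x"
proof -
  have "{shift_power n x | n. True} \<subseteq> topspace (full_shift A)"
    using assms by (force simp: topspace_full_shift shift_power_apply)
  then show ?thesis
    unfolding orbit_closure_def using closure_of_subset by blast
qed

lemma map_upto_eq_iff:
  "map y [0..int (length W) - 1] = W \<longleftrightarrow> (\<forall>i<length W. y (int i) = W ! i)"
proof -
  have "(map y [0..int (length W) - 1] ! i = W ! i) = (y (int i) = W ! i)" if "i < length W" for i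
    using that by simp
  then show ?thesis
    unfolding list_eq_iff_nth_eq
    by (metis add.commute diff_add_cancel diff_zero length_map length_upto nat_int)
qed

text \<open>A cylinder constrains finitely many coordinates, and each of these constraints is open
  because the alphabet is discrete.\<close>

lemma openin_cylinder: "openin (orbit_system A x) (cylinder A x W)"
proof -
  let ?X = "full_shift A"
  have coordinate: "openin ?X {y \<in> topspace ?X. y i = a}" for i a
  proof (cases "a \<in> A")
    case True
    have "continuous_map ?X (discrete_topology A) (\<lambda>y. y i)"
      unfolding full_shift_def by (rule continuous_map_product_projection) simp
    then have "openin ?X {y \<in> topspace ?X. y i \<in> {a}}"
      by (rule openin_continuous_map_preimage) (simp add: True)
    then show ?thesis
      by simp
  next
    case False
    then have "{y \<in> topspace ?X. y i = a} = {}"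
      by (auto simp: topspace_full_shift)
    then show ?thesis
      by (metis openin_empty)
  qed
  have "openin ?X ((\<Inter>i<length W. {y \<in> topspace ?X. y (int i) = W ! i}) \<inter> topspace ?X)"
    by (intro openin_INT coordinate) simp
  moreover have "cylinder A x W =
      ((\<Inter>i<length W. {y \<in> topspace ?X. y (int i) = W ! i}) \<inter> topspace ?X) \<inter> orbit_closure A x"
    by (auto simp: cylinder_def map_upto_eq_iff orbit_closure_def dest: in_closure_of[THEN iffD1])
  ultimately show ?thesis
    unfolding orbit_system_def openin_subtopology by blast
qed

lemma cylinder_nonempty:
  assumes "x \<in> UNIV \<rightarrow> A" and "W \<in> language x"
  shows "cylinder A x W \<noteq> {}"
proof -
  obtain n m where W: "W = map x [n..n + int m]"
    using assms(2) by (auto simp: language_def)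
  have "map (shift_power n x) [0..int (length W) - 1] = W"
    unfolding map_upto_eq_iff by (auto simp: W shift_power_apply add.commute)
  then have "shift_power n x \<in> cylinder A x W"
    using shift_power_in_orbit_closure[OF assms(1)] by (simp add: cylinder_def)
  then show ?thesis
    by blast
qed

lemma sets_cylinder:
  assumes "borel_prob_measure (orbit_system A x) \<mu>"
  shows "cylinder A x W \<in> sets \<mu>"
proof -
  have "sets \<mu> = sigma_sets (topspace (orbit_system A x)) {U. openin (orbit_system A x) U}"
    using assms unfolding borel_prob_measure_def by blast
  then show ?thesis
    by (simp add: sigma_sets.Basic openin_cylinder)
qed

lemma cylinder_measure_pos:
  assumes "x \<in> UNIV \<rightarrow> A" and "W \<in> language x"
    and borel: "borel_prob_measure (orbit_system A x) \<mu>"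
    and supp: "measure_support (orbit_system A x) \<mu> = orbit_closure A x"
  shows "0 < measure \<mu> (cylinder A x W)"
proof -
  interpret prob_space \<mu>
    using borel by (simp add: borel_prob_measure_def)
  obtain p where p: "p \<in> cylinder A x W"
    using cylinder_nonempty[OF assms(1,2)] by blast
  then have "p \<in> measure_support (orbit_system A x) \<mu>"
    unfolding supp by (simp add: cylinder_def)
  then have "emeasure \<mu> (cylinder A x W) > 0"
    using openin_cylinder p by (auto simp: measure_support_def)
  then show ?thesis
    by (simp add: emeasure_eq_measure)
qed

theorem proposition5p4:
  fixes A :: "'a set" and x :: "int \<Rightarrow> 'a" and \<mu> :: "(int \<Rightarrow> 'a) measure"
  assumes "finite A"
    and "x \<in> UNIV \<rightarrow> A"
    and "borel_prob_measure (orbit_system A x) \<mu>"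
    and "invariant_measure \<mu> shift"
    and "measure_support (orbit_system A x) \<mu> = orbit_closure A x"
    and "weakly_mixing \<mu> shift"
  shows "\<exists>J :: 'a list \<Rightarrow> 'a list \<Rightarrow> nat set.
           (\<forall>W1\<in>language x. \<forall>W2\<in>language x. density_zero (J W1 W2)) \<and>
           (\<forall>W1\<in>language x. \<forall>W2\<in>language x. \<forall>n\<in>UNIV - J W1 W2.
              cylinder A x W1 \<inter> (shift ^^ n) -` cylinder A x W2 \<noteq> {})"
proof -
  define J where "J W1 W2 = {n. cylinder A x W1 \<inter> (shift ^^ n) -` cylinder A x W2 = {}}"
    for W1 W2
  have "density_zero (J W1 W2)" if W: "W1 \<in> language x" "W2 \<in> language x" for W1 W2
  proof -
    let ?B = "cylinder A x W2" and ?C = "cylinder A x W1"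
    let ?f = "\<lambda>n. \<bar>measure \<mu> ((shift ^^ n) -` ?B \<inter> ?C) - measure \<mu> ?B * measure \<mu> ?C\<bar>"
    have pos: "0 < measure \<mu> ?B * measure \<mu> ?C"
      by (intro mult_pos_pos cylinder_measure_pos assms W)
    show ?thesis
    proof (rule density_zero_if_cesaro_null[where f = ?f, OF _ pos])
      fix n assume "n \<in> J W1 W2"
      then have "(shift ^^ n) -` ?B \<inter> ?C = {}"
        by (auto simp: J_def)
      then show "measure \<mu> ?B * measure \<mu> ?C \<le> ?f n"
        by simp
    next
      show "(\<lambda>N. (\<Sum>n<N. ?f n) / real N) \<longlonglongrightarrow> 0"
        using assms(6) sets_cylinder[OF assms(3)] unfolding weakly_mixing_def by blast
    qed simp
  qed
  then show ?thesis
    by (intro exI[of _ J]) (auto simp: J_def)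
qed

end
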